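(* Let $R$ be a domain, let $S \subseteq R$ be a left Ore set in $R$, and let $\operatorname{LSat}(S) := \{r \in R \mid \exists\, w \in R : wr \in S\}$. Then: (a) $\operatorname{LSat}(S)$ is a left Ore set in $R$. (b) $\operatorname{LSat}(S) = \rho_{S,R}^{-1}(U(S^{-1}R))$; equivalently, for $(s,r) \in S^{-1}R$ one has $(s,r) \in U(S^{-1}R)$ if and only if $r \in \operatorname{LSat}(S)$. (c) $\operatorname{LSat}(S)$ is the smallest saturated superset of $S$ in $R$ with respect to inclusion. (d) $S^{-1}R$ and $\operatorname{LSat}(S)^{-1}R$ are isomorphic via a unique $R$-fixing isomorphism.
   Context: Rings are associative, unital and non-trivial, not necessarily commutative; ring homomorphisms are unital. A domain is a ring in which $ab=0$ implies $a=0$ or $b=0$. $U(A)$ denotes the unit group of a ring $A$. A subset $S$ of $R$ is a multiplicative set if $1 \in S$, $0 \notin S$ and $st \in S$ for all $s,t \in S$. $S$ satisfies the left Ore condition in $R$ if for all $s \in S$, $r \in R$ there exist $\tilde s \in S$, $\tilde r \in R$ with $\tilde s r = \tilde r s$. A left Ore set is a multiplicative set satisfying the left Ore condition. A subset $S \subseteq R$ is saturated if for all $s,t \in R$, $st \in S$ implies $s \in S$ and $t \in S$. For a left Ore set $S$ in $R$, $S^{-1}R$ is the left Ore localization: the set of equivalence classes, again written $(s,r)$, of pairs $(s,r) \in S \times R$ under $(s_1,r_1) \sim (s_2,r_2)$ iff there exist $\tilde s \in S$, $\tilde r \in R$ with $\tilde s s_2 = \tilde r s_1$ and $\tilde s r_2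 = \tilde r r_1$. It is a ring (in fact a domain) with $(s_1,r_1)+(s_2,r_2) = (\tilde s s_1, \tilde s r_1 + \tilde r r_2)$ where $\tilde s \in S$, $\tilde r\in R$ satisfy $\tilde s s_1 = \tilde r s_2$, and $(s_1,r_1)\cdot(s_2,r_2) = (\tilde s s_1, \tilde r r_2)$ where $\tilde s \in S$, $\tilde r\in R$ satisfy $\tilde s r_1 = \tilde r s_2$. Intuitively $(s,r)$ is $s^{-1}r$. The localization map is the injective ring homomorphism $\rho_{S,R} : R \to S^{-1}R$, $r \mapsto (1,r)$. For left Ore sets $S,T$ in $R$, a ring homomorphism $\varphi : S^{-1}R \to T^{-1}R$ is $R$-fixing if $\varphi \circ \rho_{S,R} = \rho_{T,R}$. *)

theory Defs
  imports "HOL-Algebra.QuotRing"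
begin

text \<open>The library locale \<open>domain\<close> is commutative, hence a separate locale.\<close>

locale nc_domain = ring R for R (structure) +
  assumes one_neq_zero: "\<one> \<noteq> \<zero>"
    and no_zero_divisors:
      "\<lbrakk>a \<in> carrier R; b \<in> carrier R; a \<otimes> b = \<zero>\<rbrakk> \<Longrightarrow> a = \<zero> \<or> b = \<zero>"

definition multiplicative_set :: "('a, 'b) ring_scheme \<Rightarrow> 'a set \<Rightarrow> bool" where
  "multiplicative_set R S \<longleftrightarrow>
     S \<subseteq> carrier R \<and> \<one>\<^bsub>R\<^esub> \<in> S \<and> \<zero>\<^bsub>R\<^esub> \<notin> S \<and> (\<forall>s\<in>S. \<forall>t\<in>S. s \<otimes>\<^bsub>R\<^esub> t \<in> S)"

definition left_ore_condition :: "('a, 'b) ring_scheme \<Rightarrow> 'a set \<Rightarrow> bool" where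
  "left_ore_condition R S \<longleftrightarrow>
     (\<forall>s\<in>S. \<forall>r\<in>carrier R. \<exists>s'\<in>S. \<exists>r'\<in>carrier R. s' \<otimes>\<^bsub>R\<^esub> r = r' \<otimes>\<^bsub>R\<^esub> s)"

definition left_ore_set :: "('a, 'b) ring_scheme \<Rightarrow> 'a set \<Rightarrow> bool" where
  "left_ore_set R S \<longleftrightarrow> multiplicative_set R S \<and> left_ore_condition R S"

definition saturated :: "('a, 'b) ring_scheme \<Rightarrow> 'a set \<Rightarrow> bool" where
  "saturated R S \<longleftrightarrow>
     S \<subseteq> carrier R \<and>
     (\<forall>s\<in>carrier R. \<forall>t\<in>carrier R. s \<otimes>\<^bsub>R\<^esub> t \<in> S \<longrightarrow> s \<in> S \<and> t \<in> S)"

definition LSat :: "('a, 'b) ring_scheme \<Rightarrow> 'a set \<Rightarrow> 'a set" where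
  "LSat R S = {r \<in> carrier R. \<exists>w\<in>carrier R. w \<otimes>\<^bsub>R\<^esub> r \<in> S}"

definition ore_rel :: "('a, 'b) ring_scheme \<Rightarrow> 'a set \<Rightarrow> (('a \<times> 'a) \<times> ('a \<times> 'a)) set" where
  "ore_rel R S =
     {((s1, r1), (s2, r2)). s1 \<in> S \<and> r1 \<in> carrier R \<and> s2 \<in> S \<and> r2 \<in> carrier R \<and>
        (\<exists>s'\<in>S. \<exists>r'\<in>carrier R.
           s' \<otimes>\<^bsub>R\<^esub> s2 = r' \<otimes>\<^bsub>R\<^esub> s1 \<and> s' \<otimes>\<^bsub>R\<^esub> r2 = r' \<otimes>\<^bsub>R\<^esub> r1)}"

text \<open>\<open>lfrac R S s r\<close> is the class of \<open>(s, r)\<close>, that is, the left fraction with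
  denominator \<open>s\<close> and numerator \<open>r\<close>.\<close>

definition lfrac :: "('a, 'b) ring_scheme \<Rightarrow> 'a set \<Rightarrow> 'a \<Rightarrow> 'a \<Rightarrow> ('a \<times> 'a) set" where
  "lfrac R S s r = ore_rel R S `` {(s, r)}"

text \<open>Sum and product of two classes: the unique class arising from some choice of
  representatives and Ore multipliers. Every choice yields the same class; see
  \<open>add_lfrac\<close> and \<open>mult_lfrac\<close> below.\<close>

definition ore_add ::
    "('a, 'b) ring_scheme \<Rightarrow> 'a set \<Rightarrow> ('a \<times> 'a) set \<Rightarrow> ('a \<times> 'a) set \<Rightarrow> ('a \<times> 'a) set" where
  "ore_add R S X Y =
     (THE Z. \<exists>s1 r1 s2 r2. \<exists>s'\<in>S. \<exists>r'\<in>carrier R.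
        (s1, r1) \<in> X \<and> (s2, r2) \<in> Y \<and> s' \<otimes>\<^bsub>R\<^esub> s1 = r' \<otimes>\<^bsub>R\<^esub> s2 \<and>
        Z = lfrac R S (s' \<otimes>\<^bsub>R\<^esub> s1) (s' \<otimes>\<^bsub>R\<^esub> r1 \<oplus>\<^bsub>R\<^esub> r' \<otimes>\<^bsub>R\<^esub> r2))"

definition ore_mult ::
    "('a, 'b) ring_scheme \<Rightarrow> 'a set \<Rightarrow> ('a \<times> 'a) set \<Rightarrow> ('a \<times> 'a) set \<Rightarrow> ('a \<times> 'a) set" where
  "ore_mult R S X Y =
     (THE Z. \<exists>s1 r1 s2 r2. \<exists>s'\<in>S. \<exists>r'\<in>carrier R.
        (s1, r1) \<in> X \<and> (s2, r2) \<in> Y \<and> s' \<otimes>\<^bsub>R\<^esub> r1 = r' \<otimes>\<^bsub>R\<^esub> s2 \<and>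
        Z = lfrac R S (s' \<otimes>\<^bsub>R\<^esub> s1) (r' \<otimes>\<^bsub>R\<^esub> r2))"

definition ore_localization :: "('a, 'b) ring_scheme \<Rightarrow> 'a set \<Rightarrow> ('a \<times> 'a) set ring" where
  "ore_localization R S =
     \<lparr>carrier = (S \<times> carrier R) // ore_rel R S,
      mult = ore_mult R S,
      one = lfrac R S \<one>\<^bsub>R\<^esub> \<one>\<^bsub>R\<^esub>,
      zero = lfrac R S \<one>\<^bsub>R\<^esub> \<zero>\<^bsub>R\<^esub>,
      add = ore_add R S\<rparr>"

definition loc_map :: "('a, 'b) ring_scheme \<Rightarrow> 'a set \<Rightarrow> 'a \<Rightarrow> ('a \<times> 'a) set" where
  "loc_map R S r = lfrac R S \<one>\<^bsub>R\<^esub> r"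

definition R_fixing ::
    "('a, 'b) ring_scheme \<Rightarrow> 'a set \<Rightarrow> 'a set \<Rightarrow> (('a \<times> 'a) set \<Rightarrow> ('a \<times> 'a) set) \<Rightarrow> bool" where
  "R_fixing R S T \<phi> \<longleftrightarrow> (\<forall>r\<in>carrier R. \<phi> (loc_map R S r) = loc_map R T r)"


subsection \<open>The localization is well defined and a ring\<close>

locale left_ore = nc_domain +
  fixes S
  assumes ore: "left_ore_set R S"
begin

lemma S_carrier: "s \<in> S \<Longrightarrow> s \<in> carrier R"
  and S_one: "\<one> \<in> S"
  and S_zero: "\<zero> \<notin> S"
  and S_mult: "\<lbrakk>s \<in> S; t \<in> S\<rbrakk> \<Longrightarrow> s \<otimes> t \<in> S"
  using ore by (auto simp: left_ore_set_def multiplicative_set_def)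

lemma S_nz: "s \<in> S \<Longrightarrow> s \<noteq> \<zero>"
  using S_zero by blast

lemma ore_cond:
  assumes "s \<in> S" "r \<in> carrier R"
  obtains s' r' where "s' \<in> S" "r' \<in> carrier R" "s' \<otimes> r = r' \<otimes> s"
  using ore assms unfolding left_ore_set_def left_ore_condition_def by meson

lemma cancel_left:
  assumes "a \<in> carrier R" "b \<in> carrier R" "c \<in> carrier R" "c \<noteq> \<zero>" "c \<otimes> a = c \<otimes> b"
  shows "a = b"
proof -
  have "c \<otimes> (a \<ominus> b) = \<zero>"
    using assms by (simp add: a_minus_def r_distr r_minus r_neg)
  then have "a \<ominus> b = \<zero>"
    using no_zero_divisors assms by blast
  then show ?thesis using assms minus_equality[of a "\<ominus> b"] by (simp add: a_minus_def)
qed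

lemma cancel_right:
  assumes "a \<in> carrier R" "b \<in> carrier R" "c \<in> carrier R" "c \<noteq> \<zero>" "a \<otimes> c = b \<otimes> c"
  shows "a = b"
proof -
  have "(a \<ominus> b) \<otimes> c = \<zero>"
    using assms by (simp add: a_minus_def l_distr l_minus r_neg)
  then have "a \<ominus> b = \<zero>"
    using no_zero_divisors assms by blast
  then show ?thesis using assms minus_equality[of a "\<ominus> b"] by (simp add: a_minus_def)
qed

lemma rel_cross:
  assumes rel: "((s1, r1), (s2, r2)) \<in> ore_rel R S"
    and ab: "a \<in> carrier R" "b \<in> carrier R" "a \<otimes> s1 = b \<otimes> s2"
  shows "a \<otimes> r1 = b \<otimes> r2"
proof -
  obtain s' r' where s': "s' \<in> S" "r' \<in> carrier R"
      and e: "s' \<otimes> s2 = r' \<otimes> s1" "s' \<otimes> r2 = r' \<otimes> r1"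
      and c: "s1 \<in> S" "r1 \<in> carrier R" "s2 \<in> S" "r2 \<in> carrier R"
    using rel by (auto simp: ore_rel_def)
  obtain c d where cd: "c \<in> S" "d \<in> carrier R" "c \<otimes> b = d \<otimes> s'"
    using ore_cond[OF s'(1) ab(2)] by blast
  note C = c s' ab(1,2) cd(1,2) S_carrier
  have "(c \<otimes> a) \<otimes> s1 = (c \<otimes> b) \<otimes> s2" using C ab(3) by (simp add: m_assoc)
  also have "\<dots> = (d \<otimes> r') \<otimes> s1" using C cd(3) e(1) by (simp add: m_assoc)
  finally have ca: "c \<otimes> a = d \<otimes> r'"
    using cancel_right[of "c \<otimes> a" "d \<otimes> r'" s1] C S_nz by simp
  have "c \<otimes> (a \<otimes> r1) = (d \<otimes> r') \<otimes> r1" using C ca by (simp add: m_assoc[symmetric])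
  also have "\<dots> = (d \<otimes> s') \<otimes> r2" using C e(2) by (simp add: m_assoc)
  also have "\<dots> = c \<otimes> (b \<otimes> r2)" using C cd(3)[symmetric] by (simp add: m_assoc)
  finally show ?thesis
    using cancel_left[of "a \<otimes> r1" "b \<otimes> r2" c] C S_nz by simp
qed

lemma relI:
  assumes c: "s1 \<in> S" "r1 \<in> carrier R" "s2 \<in> S" "r2 \<in> carrier R"
    and ab: "a \<in> carrier R" "b \<in> carrier R" "b \<noteq> \<zero>" "a \<otimes> s1 = b \<otimes> s2" "a \<otimes> r1 = b \<otimes> r2"
  shows "((s1, r1), (s2, r2)) \<in> ore_rel R S"
proof -
  obtain s' r' where s': "s' \<in> S" "r' \<in> carrier R" "s' \<otimes> s2 = r' \<otimes> s1"
    using ore_cond[OF c(1)] c(3) S_carrier by blast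
  obtain c d where cd: "c \<in> S" "d \<in> carrier R" "c \<otimes> b = d \<otimes> s'"
    using ore_cond[OF s'(1) ab(2)] by blast
  note C = c s'(1,2) ab(1,2) cd(1,2) S_carrier
  have "d \<noteq> \<zero>"
  proof
    assume "d = \<zero>"
    then have "c \<otimes> b = \<zero>" using cd C by simp
    then show False using no_zero_divisors[of c b] C S_nz ab(3) by blast
  qed
  have "(c \<otimes> a) \<otimes> s1 = (c \<otimes> b) \<otimes> s2" using C ab(4) by (simp add: m_assoc)
  also have "\<dots> = (d \<otimes> r') \<otimes> s1" using C cd(3) s'(3) by (simp add: m_assoc)
  finally have ca: "c \<otimes> a = d \<otimes> r'"
    using cancel_right[of "c \<otimes> a" "d \<otimes> r'" s1] C S_nz by simp
  have "d \<otimes> (s' \<otimes> r2) = c \<otimes> (b \<otimes> r2)" using C cd(3) by (simp add: m_assoc[symmetric])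
  also have "\<dots> = (d \<otimes> r') \<otimes> r1" using C ab(5)[symmetric] ca by (simp add: m_assoc[symmetric])
  also have "\<dots> = d \<otimes> (r' \<otimes> r1)" using C by (simp add: m_assoc)
  finally have "s' \<otimes> r2 = r' \<otimes> r1"
    using cancel_left[of "s' \<otimes> r2" "r' \<otimes> r1" d] C \<open>d \<noteq> \<zero>\<close> by simp
  then show ?thesis using c s' by (auto simp: ore_rel_def)
qed

lemma equiv_ore_rel: "equiv (S \<times> carrier R) (ore_rel R S)"
proof (rule equivI)
  show "ore_rel R S \<subseteq> (S \<times> carrier R) \<times> (S \<times> carrier R)"
    by (auto simp: ore_rel_def)
  show "refl_on (S \<times> carrier R) (ore_rel R S)"
    by (rule refl_onI) (auto intro!: relI[of _ _ _ _ \<one> \<one>] simp: one_neq_zero)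
  show "sym (ore_rel R S)"
  proof (rule symI, clarify)
    fix s1 r1 s2 r2
    assume "((s1, r1), (s2, r2)) \<in> ore_rel R S"
    then obtain s' r' where "s1 \<in> S" "r1 \<in> carrier R" "s2 \<in> S" "r2 \<in> carrier R" "s' \<in> S"
      "r' \<in> carrier R" and e: "s' \<otimes> s2 = r' \<otimes> s1" "s' \<otimes> r2 = r' \<otimes> r1"
      by (auto simp: ore_rel_def)
    moreover have "r' \<noteq> \<zero>"
      using e(1) S_mult[of s' s2] S_zero S_carrier calculation by auto
    ultimately show "((s2, r2), (s1, r1)) \<in> ore_rel R S"
      by (intro relI[of _ _ _ _ s' r']) (auto simp: S_carrier)
  qed
  show "trans (ore_rel R S)"
  proof (rule transI, clarify)
    fix s1 r1 s2 r2 s3 r3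
    assume r12: "((s1, r1), (s2, r2)) \<in> ore_rel R S" and r23: "((s2, r2), (s3, r3)) \<in> ore_rel R S"
    obtain s' r' where c: "s1 \<in> S" "r1 \<in> carrier R" "s2 \<in> S" "r2 \<in> carrier R"
      and s': "s' \<in> S" "r' \<in> carrier R" and e: "s' \<otimes> s2 = r' \<otimes> s1"
      using r12 by (auto simp: ore_rel_def)
    have c3: "s3 \<in> S" "r3 \<in> carrier R" using r23 by (auto simp: ore_rel_def)
    obtain x y where xy: "x \<in> S" "y \<in> carrier R" "x \<otimes> s3 = y \<otimes> (s' \<otimes> s2)"
      using ore_cond[of "s' \<otimes> s2" s3] S_mult S_carrier s' c c3 by metis
    note C = c c3 s' xy(1,2) S_carrier
    have "(y \<otimes> r') \<otimes> r1 = (y \<otimes> s') \<otimes> r2"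
      using C e by (intro rel_cross[OF r12]) (auto simp: m_assoc)
    also have "\<dots> = x \<otimes> r3"
      using C xy(3) by (intro rel_cross[OF r23]) (auto simp: m_assoc)
    finally show "((s1, r1), (s3, r3)) \<in> ore_rel R S"
      using C xy(3) e S_nz by (intro relI[of _ _ _ _ "y \<otimes> r'" x]) (auto simp: m_assoc)
  qed
qed

lemma lfrac_eq_iff:
  assumes "s1 \<in> S" "r1 \<in> carrier R" "s2 \<in> S" "r2 \<in> carrier R"
  shows "lfrac R S s1 r1 = lfrac R S s2 r2 \<longleftrightarrow> ((s1, r1), (s2, r2)) \<in> ore_rel R S"
  unfolding lfrac_def using assms by (intro eq_equiv_class_iff[OF equiv_ore_rel]) auto

lemma lfrac_mem_iff: "(s', r') \<in> lfrac R S s r \<longleftrightarrow> ((s, r), (s', r')) \<in> ore_rel R S"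
  by (simp add: lfrac_def)

lemma lfrac_self: "\<lbrakk>s \<in> S; r \<in> carrier R\<rbrakk> \<Longrightarrow> (s, r) \<in> lfrac R S s r"
  unfolding lfrac_def using equiv_class_self[OF equiv_ore_rel, of "(s, r)"] by auto

lemma lfrac_expand:
  assumes "s \<in> S" "r \<in> carrier R" "a \<in> S"
  shows "lfrac R S (a \<otimes> s) (a \<otimes> r) = lfrac R S s r"
  using assms S_mult S_carrier one_neq_zero S_nz
  by (subst lfrac_eq_iff) (auto intro!: relI[of _ _ _ _ \<one> a])

lemma add_lfrac:
  assumes c: "s1 \<in> S" "r1 \<in> carrier R" "s2 \<in> S" "r2 \<in> carrier R"
    and s': "s' \<in> S" "r' \<in> carrier R" "s' \<otimes> s1 = r' \<otimes> s2"
  shows "ore_add R S (lfrac R S s1 r1) (lfrac R S s2 r2) =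
         lfrac R S (s' \<otimes> s1) (s' \<otimes> r1 \<oplus> r' \<otimes> r2)"
  unfolding ore_add_def
proof (rule the_equality)
  show "\<exists>t1 q1 t2 q2. \<exists>t'\<in>S. \<exists>q'\<in>carrier R.
        (t1, q1) \<in> lfrac R S s1 r1 \<and> (t2, q2) \<in> lfrac R S s2 r2 \<and> t' \<otimes> t1 = q' \<otimes> t2 \<and>
        lfrac R S (s' \<otimes> s1) (s' \<otimes> r1 \<oplus> r' \<otimes> r2) = lfrac R S (t' \<otimes> t1) (t' \<otimes> q1 \<oplus> q' \<otimes> q2)"
    using assms lfrac_self by blast
next
  fix Z
  assume "\<exists>t1 q1 t2 q2. \<exists>t'\<in>S. \<exists>q'\<in>carrier R.
        (t1, q1) \<in> lfrac R S s1 r1 \<and> (t2, q2) \<in> lfrac R S s2 r2 \<and> t' \<otimes> t1 = q' \<otimes> t2 \<and>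
        Z = lfrac R S (t' \<otimes> t1) (t' \<otimes> q1 \<oplus> q' \<otimes> q2)"
  then obtain t1 q1 t2 q2 t' q' where t': "t' \<in> S" "q' \<in> carrier R" "t' \<otimes> t1 = q' \<otimes> t2"
    and rel: "((s1, r1), (t1, q1)) \<in> ore_rel R S" "((s2, r2), (t2, q2)) \<in> ore_rel R S"
    and Z: "Z = lfrac R S (t' \<otimes> t1) (t' \<otimes> q1 \<oplus> q' \<otimes> q2)"
    by (auto simp: lfrac_mem_iff)
  have ct: "t1 \<in> S" "q1 \<in> carrier R" "t2 \<in> S" "q2 \<in> carrier R"
    using rel by (auto simp: ore_rel_def)
  obtain p q where pq: "p \<in> S" "q \<in> carrier R" "p \<otimes> (t' \<otimes> t1) = q \<otimes> (s' \<otimes> s1)"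
    using ore_cond[of "s' \<otimes> s1" "t' \<otimes> t1"] S_mult S_carrier s' c ct t' by metis
  note C = c ct s'(1,2) t'(1,2) pq(1,2) S_carrier
  have 1: "(q \<otimes> s') \<otimes> r1 = (p \<otimes> t') \<otimes> q1"
    using C pq(3) by (intro rel_cross[OF rel(1)]) (auto simp: m_assoc)
  have 2: "(q \<otimes> r') \<otimes> r2 = (p \<otimes> q') \<otimes> q2"
    using C pq(3) s'(3) t'(3) by (intro rel_cross[OF rel(2)]) (auto simp: m_assoc)
  show "Z = lfrac R S (s' \<otimes> s1) (s' \<otimes> r1 \<oplus> r' \<otimes> r2)"
    unfolding Z
  proof (rule sym, subst lfrac_eq_iff)
    show "((s' \<otimes> s1, s' \<otimes> r1 \<oplus> r' \<otimes> r2), t' \<otimes> t1, t' \<otimes> q1 \<oplus> q' \<otimes> q2) \<in> ore_rel R S"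
      using C pq(3) 1 2 S_nz S_mult
      by (intro relI[of _ _ _ _ q p]) (auto simp: r_distr m_assoc)
  qed (use C S_mult in auto)
qed

lemma mult_lfrac:
  assumes c: "s1 \<in> S" "r1 \<in> carrier R" "s2 \<in> S" "r2 \<in> carrier R"
    and s': "s' \<in> S" "r' \<in> carrier R" "s' \<otimes> r1 = r' \<otimes> s2"
  shows "ore_mult R S (lfrac R S s1 r1) (lfrac R S s2 r2) = lfrac R S (s' \<otimes> s1) (r' \<otimes> r2)"
  unfolding ore_mult_def
proof (rule the_equality)
  show "\<exists>t1 q1 t2 q2. \<exists>t'\<in>S. \<exists>q'\<in>carrier R.
        (t1, q1) \<in> lfrac R S s1 r1 \<and> (t2, q2) \<in> lfrac R S s2 r2 \<and> t' \<otimes> q1 = q' \<otimes> t2 \<and>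
        lfrac R S (s' \<otimes> s1) (r' \<otimes> r2) = lfrac R S (t' \<otimes> t1) (q' \<otimes> q2)"
    using assms lfrac_self by blast
next
  fix Z
  assume "\<exists>t1 q1 t2 q2. \<exists>t'\<in>S. \<exists>q'\<in>carrier R.
        (t1, q1) \<in> lfrac R S s1 r1 \<and> (t2, q2) \<in> lfrac R S s2 r2 \<and> t' \<otimes> q1 = q' \<otimes> t2 \<and>
        Z = lfrac R S (t' \<otimes> t1) (q' \<otimes> q2)"
  then obtain t1 q1 t2 q2 t' q' where t': "t' \<in> S" "q' \<in> carrier R" "t' \<otimes> q1 = q' \<otimes> t2"
    and rel: "((s1, r1), (t1, q1)) \<in> ore_rel R S" "((s2, r2), (t2, q2)) \<in> ore_rel R S"
    and Z: "Z = lfrac R S (t' \<otimes> t1) (q' \<otimes> q2)"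
    by (auto simp: lfrac_mem_iff)
  have ct: "t1 \<in> S" "q1 \<in> carrier R" "t2 \<in> S" "q2 \<in> carrier R"
    using rel by (auto simp: ore_rel_def)
  obtain p q where pq: "p \<in> S" "q \<in> carrier R" "p \<otimes> (t' \<otimes> t1) = q \<otimes> (s' \<otimes> s1)"
    using ore_cond[of "s' \<otimes> s1" "t' \<otimes> t1"] S_mult S_carrier s' c ct t' by metis
  note C = c ct s'(1,2) t'(1,2) pq(1,2) S_carrier
  have 1: "(q \<otimes> s') \<otimes> r1 = (p \<otimes> t') \<otimes> q1"
    using C pq(3) by (intro rel_cross[OF rel(1)]) (auto simp: m_assoc)
  have 2: "(q \<otimes> r') \<otimes> r2 = (p \<otimes> q') \<otimes> q2"
    using C 1 s'(3) t'(3) by (intro rel_cross[OF rel(2)]) (auto simp: m_assoc)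
  show "Z = lfrac R S (s' \<otimes> s1) (r' \<otimes> r2)"
    unfolding Z
  proof (rule sym, subst lfrac_eq_iff)
    show "((s' \<otimes> s1, r' \<otimes> r2), t' \<otimes> t1, q' \<otimes> q2) \<in> ore_rel R S"
      using C pq(3) 2 S_nz S_mult
      by (intro relI[of _ _ _ _ q p]) (auto simp: m_assoc)
  qed (use C S_mult in auto)
qed

abbreviation L where "L \<equiv> ore_localization R S"

lemma L_simps:
  "carrier L = (S \<times> carrier R) // ore_rel R S" "mult L = ore_mult R S" "add L = ore_add R S"
  "\<one>\<^bsub>L\<^esub> = lfrac R S \<one> \<one>" "\<zero>\<^bsub>L\<^esub> = lfrac R S \<one> \<zero>"
  by (simp_all add: ore_localization_def)

lemma lfrac_closed: "\<lbrakk>s \<in> S; r \<in> carrier R\<rbrakk> \<Longrightarrow> lfrac R S s r \<in> carrier L"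
  by (auto simp: L_simps lfrac_def intro: quotientI)

lemma L_cases:
  assumes "X \<in> carrier L"
  obtains s r where "s \<in> S" "r \<in> carrier R" "X = lfrac R S s r"
  using assms by (auto simp: L_simps lfrac_def elim!: quotientE)

lemma add_same:
  assumes "s \<in> S" "a \<in> carrier R" "b \<in> carrier R"
  shows "lfrac R S s a \<oplus>\<^bsub>L\<^esub> lfrac R S s b = lfrac R S s (a \<oplus> b)"
  using add_lfrac[of s a s b \<one> \<one>] assms S_one S_carrier by (simp add: L_simps)

lemma mult_match:
  assumes "s \<in> S" "a \<in> carrier R" "t \<in> S" "b \<in> carrier R"
  shows "lfrac R S s (a \<otimes> t) \<otimes>\<^bsub>L\<^esub> lfrac R S t b = lfrac R S s (a \<otimes> b)"
  using mult_lfrac[of s "a \<otimes> t" t b \<one> a] assms S_one S_carrier by (simp add: L_simps)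

lemma match:
  assumes "s \<in> S" "r \<in> carrier R" "t \<in> S"
  obtains s' a where "s' \<in> S" "a \<in> carrier R" "lfrac R S s r = lfrac R S s' (a \<otimes> t)"
proof -
  obtain p a where "p \<in> S" "a \<in> carrier R" "p \<otimes> r = a \<otimes> t"
    using ore_cond[of t r] assms by metis
  with that[of "p \<otimes> s" a] lfrac_expand[of s r p] assms S_mult show thesis by simp
qed

lemma common2:
  assumes "X \<in> carrier L" "Y \<in> carrier L"
  obtains s a b where "s \<in> S" "a \<in> carrier R" "b \<in> carrier R"
    "X = lfrac R S s a" "Y = lfrac R S s b"
proof -
  obtain s1 r1 where 1: "s1 \<in> S" "r1 \<in> carrier R" "X = lfrac R S s1 r1"
    using L_cases[OF assms(1)] .
  obtain s2 r2 where 2: "s2 \<in> S" "r2 \<in> carrier R" "Y = lfrac R S s2 r2"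
    using L_cases[OF assms(2)] .
  obtain p q where pq: "p \<in> S" "q \<in> carrier R" "p \<otimes> s1 = q \<otimes> s2"
    using ore_cond[of s2 s1] 1 2 S_carrier by metis
  have ps: "p \<otimes> s1 \<in> S" using pq 1 S_mult by blast
  have "lfrac R S (p \<otimes> s1) (q \<otimes> r2) = Y"
    unfolding 2(3) using 1 2 pq S_carrier ps S_nz
    by (subst lfrac_eq_iff, simp_all)
      (rule relI[of _ _ _ _ \<one> q], auto dest: S_nz)
  moreover have "lfrac R S (p \<otimes> s1) (p \<otimes> r1) = X"
    using lfrac_expand[of s1 r1 p] 1 pq(1) by auto
  ultimately show thesis
    using that[OF ps, of "p \<otimes> r1" "q \<otimes> r2"] 1 2 pq S_carrier by simp
qed

lemma common3:
  assumes "X \<in> carrier L" "Y \<in> carrier L" "Z \<in> carrier L"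
  obtains s a b c where "s \<in> S" "a \<in> carrier R" "b \<in> carrier R" "c \<in> carrier R"
    "X = lfrac R S s a" "Y = lfrac R S s b" "Z = lfrac R S s c"
proof -
  obtain t a b where 1: "t \<in> S" "a \<in> carrier R" "b \<in> carrier R"
    "X = lfrac R S t a" "Y = lfrac R S t b"
    using common2[OF assms(1,2)] .
  obtain s3 r3 where 3: "s3 \<in> S" "r3 \<in> carrier R" "Z = lfrac R S s3 r3"
    using L_cases[OF assms(3)] .
  obtain p q where pq: "p \<in> S" "q \<in> carrier R" "p \<otimes> t = q \<otimes> s3"
    using ore_cond[of s3 t] 1 3 S_carrier by metis
  have ps: "p \<otimes> t \<in> S" using pq 1 S_mult by blast
  have "lfrac R S (p \<otimes> t) (q \<otimes> r3) = Z"
    unfolding 3(3) using 1 3 pq S_carrier ps S_nz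
    by (subst lfrac_eq_iff, simp_all)
      (rule relI[of _ _ _ _ \<one> q], auto dest: S_nz)
  moreover have "lfrac R S (p \<otimes> t) (p \<otimes> a) = X" "lfrac R S (p \<otimes> t) (p \<otimes> b) = Y"
    using lfrac_expand[of t a p] lfrac_expand[of t b p] 1 pq(1) by auto
  ultimately show thesis
    using that[OF ps, of "p \<otimes> a" "p \<otimes> b" "q \<otimes> r3"] 1 3 pq S_carrier by simp
qed

lemma zero_lfrac: "s \<in> S \<Longrightarrow> \<zero>\<^bsub>L\<^esub> = lfrac R S s \<zero>"
  using lfrac_expand[of \<one> \<zero> s] S_one S_carrier by (simp add: L_simps)

lemma one_lfrac: "s \<in> S \<Longrightarrow> \<one>\<^bsub>L\<^esub> = lfrac R S s s"
  using lfrac_expand[of \<one> \<one> s] S_one S_carrier by (simp add: L_simps)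

theorem ring_localization: "ring L"
proof (rule ringI)
  show "abelian_group L"
  proof (rule abelian_groupI)
    fix X Y assume XY: "X \<in> carrier L" "Y \<in> carrier L"
    show "X \<oplus>\<^bsub>L\<^esub> Y \<in> carrier L" "X \<oplus>\<^bsub>L\<^esub> Y = Y \<oplus>\<^bsub>L\<^esub> X"
      using common2[OF XY] by (metis add_same lfrac_closed a_closed a_comm)+
  next
    fix X Y Z assume XYZ: "X \<in> carrier L" "Y \<in> carrier L" "Z \<in> carrier L"
    show "X \<oplus>\<^bsub>L\<^esub> Y \<oplus>\<^bsub>L\<^esub> Z = X \<oplus>\<^bsub>L\<^esub> (Y \<oplus>\<^bsub>L\<^esub> Z)"
      by (rule common3[OF XYZ]) (simp add: add_same a_assoc)
  next
    show "\<zero>\<^bsub>L\<^esub> \<in> carrier L" using zero_lfrac[OF S_one] lfrac_closed S_one by simp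
  next
    fix X assume X: "X \<in> carrier L"
    obtain s r where sr: "s \<in> S" "r \<in> carrier R" "X = lfrac R S s r" using L_cases[OF X] .
    show "\<zero>\<^bsub>L\<^esub> \<oplus>\<^bsub>L\<^esub> X = X" using sr by (simp add: zero_lfrac[of s] add_same)
    show "\<exists>Y\<in>carrier L. Y \<oplus>\<^bsub>L\<^esub> X = \<zero>\<^bsub>L\<^esub>"
      using sr by (intro bexI[of _ "lfrac R S s (\<ominus> r)"])
        (simp_all add: zero_lfrac[of s] add_same lfrac_closed l_neg)
  qed
  show "monoid L"
  proof (rule monoidI)
    show "\<one>\<^bsub>L\<^esub> \<in> carrier L" using lfrac_closed S_one by (simp add: L_simps)
  next
    fix X Y assume XY: "X \<in> carrier L" "Y \<in> carrier L"
    obtain s r where Y: "s \<in> S" "r \<in> carrier R" "Y = lfrac R S s r" using L_cases[OF XY(2)] .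
    obtain t a where X: "t \<in> S" "a \<in> carrier R" "X = lfrac R S t (a \<otimes> s)"
      using L_cases[OF XY(1)] match Y(1) by metis
    show "X \<otimes>\<^bsub>L\<^esub> Y \<in> carrier L" using X Y by (simp add: mult_match lfrac_closed)
  next
    fix X Y Z assume XYZ: "X \<in> carrier L" "Y \<in> carrier L" "Z \<in> carrier L"
    obtain s r where Z: "s \<in> S" "r \<in> carrier R" "Z = lfrac R S s r" using L_cases[OF XYZ(3)] .
    obtain t a where Y: "t \<in> S" "a \<in> carrier R" "Y = lfrac R S t (a \<otimes> s)"
      using L_cases[OF XYZ(2)] match Z(1) by metis
    obtain u b where X: "u \<in> S" "b \<in> carrier R" "X = lfrac R S u (b \<otimes> t)"
      using L_cases[OF XYZ(1)] match Y(1) by metis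
    have "X \<otimes>\<^bsub>L\<^esub> Y = lfrac R S u ((b \<otimes> a) \<otimes> s)"
      using X Y Z S_carrier by (simp add: mult_match m_assoc)
    then show "X \<otimes>\<^bsub>L\<^esub> Y \<otimes>\<^bsub>L\<^esub> Z = X \<otimes>\<^bsub>L\<^esub> (Y \<otimes>\<^bsub>L\<^esub> Z)"
      using X Y Z S_carrier mult_match[of u "b \<otimes> a" s r] by (simp add: mult_match m_assoc)
  next
    fix X assume X: "X \<in> carrier L"
    obtain s r where sr: "s \<in> S" "r \<in> carrier R" "X = lfrac R S s r" using L_cases[OF X] .
    show "\<one>\<^bsub>L\<^esub> \<otimes>\<^bsub>L\<^esub> X = X"
      using sr mult_match[of s \<one> s r] S_carrier by (simp add: one_lfrac[of s])
    show "X \<otimes>\<^bsub>L\<^esub> \<one>\<^bsub>L\<^esub> = X"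
      using sr mult_match[of s r \<one> \<one>] S_one by (simp add: L_simps(4))
  qed
  fix X Y Z assume XYZ: "X \<in> carrier L" "Y \<in> carrier L" "Z \<in> carrier L"
  show "(X \<oplus>\<^bsub>L\<^esub> Y) \<otimes>\<^bsub>L\<^esub> Z = X \<otimes>\<^bsub>L\<^esub> Z \<oplus>\<^bsub>L\<^esub> Y \<otimes>\<^bsub>L\<^esub> Z"
  proof -
    obtain t z where Z: "t \<in> S" "z \<in> carrier R" "Z = lfrac R S t z" using L_cases[OF XYZ(3)] .
    obtain s a b where s: "s \<in> S" "a \<in> carrier R" "b \<in> carrier R"
      "X = lfrac R S s a" "Y = lfrac R S s b"
      using common2[OF XYZ(1,2)] .
    obtain p a' where p: "p \<in> S" "a' \<in> carrier R" "p \<otimes> a = a' \<otimes> t"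
      using ore_cond[of t a] s Z by metis
    have pb: "p \<otimes> b \<in> carrier R" using p s S_carrier by simp
    obtain q b' where q: "q \<in> S" "b' \<in> carrier R" "q \<otimes> (p \<otimes> b) = b' \<otimes> t"
      using ore_cond[OF Z(1) pb] by metis
    define u where "u = q \<otimes> (p \<otimes> s)"
    have u: "u \<in> S" using p q s S_mult by (simp add: u_def)
    note C = Z(1,2) s(1-3) p(1,2) q(1,2) S_carrier S_mult
    have "X = lfrac R S u (q \<otimes> (p \<otimes> a))"
      unfolding u_def s(4) using C by (simp add: lfrac_expand)
    then have X: "X = lfrac R S u ((q \<otimes> a') \<otimes> t)" using C p(3) by (simp add: m_assoc)
    have "Y = lfrac R S u (q \<otimes> (p \<otimes> b))"
      unfolding u_def s(5) using C by (simp add: lfrac_expand)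
    then have Y: "Y = lfrac R S u (b' \<otimes> t)" using q(3) by simp
    have XY: "X \<oplus>\<^bsub>L\<^esub> Y = lfrac R S u ((q \<otimes> a' \<oplus> b') \<otimes> t)"
      unfolding X Y using C u by (simp add: add_same l_distr)
    have "(X \<oplus>\<^bsub>L\<^esub> Y) \<otimes>\<^bsub>L\<^esub> Z = lfrac R S u ((q \<otimes> a' \<oplus> b') \<otimes> z)"
      unfolding XY Z(3) using C u by (intro mult_match) auto
    moreover have "X \<otimes>\<^bsub>L\<^esub> Z = lfrac R S u ((q \<otimes> a') \<otimes> z)"
      unfolding X Z(3) using C u by (intro mult_match) auto
    moreover have "Y \<otimes>\<^bsub>L\<^esub> Z = lfrac R S u (b' \<otimes> z)"
      unfolding Y Z(3) using C u by (intro mult_match) auto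
    ultimately show ?thesis using C u by (simp add: add_same l_distr)
  qed
  show "Z \<otimes>\<^bsub>L\<^esub> (X \<oplus>\<^bsub>L\<^esub> Y) = Z \<otimes>\<^bsub>L\<^esub> X \<oplus>\<^bsub>L\<^esub> Z \<otimes>\<^bsub>L\<^esub> Y"
  proof -
    obtain s a b where s: "s \<in> S" "a \<in> carrier R" "b \<in> carrier R"
      "X = lfrac R S s a" "Y = lfrac R S s b"
      using common2[OF XYZ(1,2)] .
    obtain t c where Z: "t \<in> S" "c \<in> carrier R" "Z = lfrac R S t (c \<otimes> s)"
      using L_cases[OF XYZ(3)] match s(1) by metis
    show ?thesis using s Z by (simp add: add_same mult_match r_distr)
  qed
qed

end

end

theory Submission
  imports Defs
begin

text \<open>In the domain \<open>R\<close> the Ore condition for \<open>S\<close> turns one-sided information into two-sided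
  information. The central case: if \<open>a t \<in> S\<close>, then applying the Ore condition to
  \<open>a t\<close> and \<open>t\<close> gives \<open>s' t = r' a t\<close>, hence \<open>s' = r' a\<close> after cancelling \<open>t\<close>. Thus the left factor of an
  element of \<open>S\<close> lies in \<open>LSat R S\<close>, not only the right factor, and saturation follows
  (\<open>saturated_LSat\<close>). Similar multiplier computations show that \<open>LSat R S\<close> is a left Ore
  set (\<open>left_ore_set_LSat\<close>), and that \<open>s\<inverse> r\<close> is a unit exactly if
  \<open>w r \<in> S\<close> for some \<open>w\<close>, its inverse then being \<open>(w r)\<inverse> (w s)\<close> (\<open>lfrac_Units_iff\<close>).

  For an inclusion \<open>S \<subseteq> T\<close> of left Ore sets, \<open>s\<inverse> r \<mapsto> s\<inverse> r\<close> is an injective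
  homomorphism, since two fractions can be brought to a common denominator. It is the only
  homomorphism over \<open>R\<close>, because the image of \<open>s\<inverse> r\<close> has to solve the equation \<open>s x = r\<close>.
  For \<open>T \<subseteq> LSat R S\<close> it is surjective: if \<open>w t \<in> S\<close>, then \<open>t\<inverse> r = (w t)\<inverse> (w r)\<close>.\<close>

section \<open>The left saturation of a left Ore set\<close>

context left_ore
begin

lemma LSatI: "\<lbrakk>w \<otimes> r \<in> S; w \<in> carrier R; r \<in> carrier R\<rbrakk> \<Longrightarrow> r \<in> LSat R S"
  by (auto simp: LSat_def)

lemma LSatE:
  assumes "r \<in> LSat R S"
  obtains w where "r \<in> carrier R" "w \<in> carrier R" "w \<otimes> r \<in> S"
  using assms by (auto simp: LSat_def)

lemma S_subset_LSat: "S \<subseteq> LSat R S"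
  by (auto intro: LSatI[of \<one>] simp: S_carrier)

lemma LSat_left_factor:
  assumes c: "a \<in> carrier R" "t \<in> carrier R" and at: "a \<otimes> t \<in> S"
  shows "a \<in> LSat R S"
proof -
  have "t \<noteq> \<zero>" using S_nz[OF at] c by auto
  obtain s' r' where s': "s' \<in> S" "r' \<in> carrier R" "s' \<otimes> t = r' \<otimes> (a \<otimes> t)"
    using ore_cond[OF at c(2)] .
  have "s' = r' \<otimes> a"
    using cancel_right[of s' "r' \<otimes> a" t] c s' S_carrier \<open>t \<noteq> \<zero>\<close> by (simp add: m_assoc)
  then show ?thesis using LSatI[of r' a] s' c by simp
qed

lemma saturated_LSat: "saturated R (LSat R S)"
  unfolding saturated_def
proof (intro conjI ballI impI)
  show "LSat R S \<subseteq> carrier R" by (auto simp: LSat_def)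
next
  fix s t assume c: "s \<in> carrier R" "t \<in> carrier R" and st: "s \<otimes> t \<in> LSat R S"
  obtain w where w: "w \<in> carrier R" "w \<otimes> (s \<otimes> t) \<in> S" using LSatE[OF st] .
  have wst: "(w \<otimes> s) \<otimes> t \<in> S" using w c by (simp add: m_assoc)
  show "t \<in> LSat R S" using LSatI[OF wst] w c by simp
  have "w \<otimes> s \<in> LSat R S" using LSat_left_factor[OF _ _ wst] w c by simp
  then obtain x where "x \<in> carrier R" "x \<otimes> (w \<otimes> s) \<in> S" by (rule LSatE)
  then show "s \<in> LSat R S" using LSatI[of "x \<otimes> w" s] w c by (simp add: m_assoc)
qed

lemma LSat_least:
  assumes "saturated R T" "S \<subseteq> T"
  shows "LSat R S \<subseteq> T"
proof
  fix r assume "r \<in> LSat R S"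
  then obtain w where "r \<in> carrier R" "w \<in> carrier R" "w \<otimes> r \<in> S" by (rule LSatE)
  then show "r \<in> T" using assms unfolding saturated_def by blast
qed

lemma left_ore_set_LSat: "left_ore_set R (LSat R S)"
  unfolding left_ore_set_def multiplicative_set_def left_ore_condition_def
proof (intro conjI ballI)
  show "LSat R S \<subseteq> carrier R" by (auto simp: LSat_def)
  show "\<one> \<in> LSat R S" using S_subset_LSat S_one by blast
  show "\<zero> \<notin> LSat R S" using S_zero by (auto simp: LSat_def)
next
  fix r1 r2 assume "r1 \<in> LSat R S" "r2 \<in> LSat R S"
  then obtain w1 w2 where r: "r1 \<in> carrier R" "r2 \<in> carrier R"
      and w: "w1 \<in> carrier R" "w1 \<otimes> r1 \<in> S" "w2 \<in> carrier R" "w2 \<otimes> r2 \<in> S"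
    by (auto elim!: LSatE)
  obtain s' r' where s': "s' \<in> S" "r' \<in> carrier R" "s' \<otimes> w2 = r' \<otimes> (w1 \<otimes> r1)"
    using ore_cond[OF w(2,3)] .
  have "(r' \<otimes> w1) \<otimes> (r1 \<otimes> r2) = (r' \<otimes> (w1 \<otimes> r1)) \<otimes> r2"
    using r w s'(2) by (simp add: m_assoc)
  also have "\<dots> = s' \<otimes> (w2 \<otimes> r2)"
    using r w s' S_carrier by (simp add: s'(3)[symmetric] m_assoc)
  finally have "(r' \<otimes> w1) \<otimes> (r1 \<otimes> r2) \<in> S" using S_mult s' w by simp
  then show "r1 \<otimes> r2 \<in> LSat R S" by (rule LSatI) (use r w s' in simp_all)
next
  fix s r assume s: "s \<in> LSat R S" and r: "r \<in> carrier R"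
  obtain w where w: "s \<in> carrier R" "w \<in> carrier R" "w \<otimes> s \<in> S" using LSatE[OF s] .
  obtain s' r' where s': "s' \<in> S" "r' \<in> carrier R" "s' \<otimes> r = r' \<otimes> (w \<otimes> s)"
    using ore_cond[OF w(3) r] .
  then have "s' \<otimes> r = (r' \<otimes> w) \<otimes> s" using w by (simp add: m_assoc)
  then show "\<exists>s'\<in>LSat R S. \<exists>r'\<in>carrier R. s' \<otimes> r = r' \<otimes> s"
    using s' w S_subset_LSat by blast
qed


section \<open>Units of the localization\<close>

lemma lfrac_same_denom_iff:
  assumes "s \<in> S" "a \<in> carrier R" "b \<in> carrier R"
  shows "lfrac R S s a = lfrac R S s b \<longleftrightarrow> a = b"
proof
  assume "lfrac R S s a = lfrac R S s b"
  then have "((s, a), (s, b)) \<in> ore_rel R S" using assms by (simp add: lfrac_eq_iff)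
  from rel_cross[OF this, of \<one> \<one>] show "a = b" using assms by simp
qed simp

lemma lfrac_Units_iff:
  assumes s: "s \<in> S" and r: "r \<in> carrier R"
  shows "lfrac R S s r \<in> Units L \<longleftrightarrow> r \<in> LSat R S"
proof
  assume "lfrac R S s r \<in> Units L"
  then obtain Y where Y: "Y \<in> carrier L" "Y \<otimes>\<^bsub>L\<^esub> lfrac R S s r = \<one>\<^bsub>L\<^esub>"
    by (auto simp: Units_def)
  obtain t a where t: "t \<in> S" "a \<in> carrier R" "Y = lfrac R S t (a \<otimes> s)"
    using L_cases[OF Y(1)] match s by metis
  have "lfrac R S t (a \<otimes> r) = lfrac R S t t"
    using Y(2) mult_match[OF t(1,2) s r] one_lfrac[OF t(1)] t(3) by simp
  then have "a \<otimes> r = t" using lfrac_same_denom_iff t r S_carrier by simp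
  then show "r \<in> LSat R S" using t r LSatI[of a r] by simp
next
  assume "r \<in> LSat R S"
  then obtain w where w: "w \<in> carrier R" "w \<otimes> r \<in> S" by (rule LSatE)
  let ?X = "lfrac R S s r" and ?Y = "lfrac R S (w \<otimes> r) (w \<otimes> s)"
  have rnz: "r \<noteq> \<zero>" using S_nz[OF w(2)] w(1) by auto
  have ws: "w \<otimes> s \<in> carrier R" using w s S_carrier by simp
  have YX: "?Y \<otimes>\<^bsub>L\<^esub> ?X = \<one>\<^bsub>L\<^esub>"
    using mult_match[OF w(2,1) s r] one_lfrac[OF w(2)] by simp
  \<comment> \<open>The numerator \<open>r\<close> is made a left multiple of the denominator \<open>w r\<close>; cancelling \<open>r\<close>
    then shows that the multiplier equals \<open>a w\<close>.\<close>
  obtain p a where p: "p \<in> S" "a \<in> carrier R" "p \<otimes> r = a \<otimes> (w \<otimes> r)"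
    using ore_cond[OF w(2) r] .
  have paw: "p = a \<otimes> w"
    using cancel_right[of p "a \<otimes> w" r] p w r rnz S_carrier by (simp add: m_assoc)
  have ps: "p \<otimes> s \<in> S" using S_mult p s by simp
  have "?X = lfrac R S (p \<otimes> s) (a \<otimes> (w \<otimes> r))"
    using lfrac_expand[OF s r p(1)] p(3) by simp
  then have "?X \<otimes>\<^bsub>L\<^esub> ?Y = lfrac R S (p \<otimes> s) (a \<otimes> (w \<otimes> s))"
    using mult_match[OF ps p(2) w(2) ws] by simp
  also have "a \<otimes> (w \<otimes> s) = p \<otimes> s"
    using paw p w s S_carrier by (simp add: m_assoc)
  finally have "?X \<otimes>\<^bsub>L\<^esub> ?Y = \<one>\<^bsub>L\<^esub>" using one_lfrac[OF ps] by simp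
  with YX show "?X \<in> Units L"
    using lfrac_closed s r w ws by (auto simp: Units_def)
qed

lemma loc_map_Units_iff:
  "r \<in> carrier R \<Longrightarrow> loc_map R S r \<in> Units L \<longleftrightarrow> r \<in> LSat R S"
  unfolding loc_map_def using S_one by (rule lfrac_Units_iff)

lemma loc_map_mult_lfrac:
  assumes "s \<in> S" "r \<in> carrier R"
  shows "loc_map R S s \<otimes>\<^bsub>L\<^esub> lfrac R S s r = loc_map R S r"
  using mult_match[of \<one> \<one> s r] assms S_one S_carrier by (simp add: loc_map_def)

end


section \<open>Enlarging the set of denominators\<close>

locale left_ore_subset = left_ore R S + T: left_ore R T
  for R (structure) and S T +
  assumes subset: "S \<subseteq> T"
begin

text \<open>The map \<open>s\<inverse> r \<mapsto> s\<inverse> r\<close> from \<open>S\<inverse> R\<close> to \<open>T\<inverse> R\<close>: a class for \<open>S\<close> is enlarged to the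
  class for \<open>T\<close> that contains it. Outside the carrier the value is \<open>undefined\<close>.\<close>

definition loc_incl :: "('a \<times> 'a) set \<Rightarrow> ('a \<times> 'a) set" where
  "loc_incl = (\<lambda>X\<in>carrier L. ore_rel R T `` X)"

lemma loc_incl_lfrac:
  assumes sr: "s \<in> S" "r \<in> carrier R"
  shows "loc_incl (lfrac R S s r) = lfrac R T s r"
proof -
  have sub: "ore_rel R S \<subseteq> ore_rel R T"
    using subset by (fastforce simp: ore_rel_def)
  have "ore_rel R T `` lfrac R S s r = lfrac R T s r"
  proof
    show "ore_rel R T `` lfrac R S s r \<subseteq> lfrac R T s r"
      using sub T.equiv_ore_rel unfolding lfrac_def equiv_def by (blast dest: transD)
    show "lfrac R T s r \<subseteq> ore_rel R T `` lfrac R S s r"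
      using lfrac_self[OF sr] unfolding lfrac_def by blast
  qed
  then show ?thesis using lfrac_closed[OF sr] by (simp add: loc_incl_def)
qed

lemma loc_incl_hom: "loc_incl \<in> ring_hom L T.L"
proof (rule ring_hom_memI)
  fix X assume "X \<in> carrier L"
  then show "loc_incl X \<in> carrier T.L"
    using L_cases loc_incl_lfrac T.lfrac_closed subset by (metis subsetD)
next
  fix X Y assume XY: "X \<in> carrier L" "Y \<in> carrier L"
  obtain s r where Y: "s \<in> S" "r \<in> carrier R" "Y = lfrac R S s r" using L_cases[OF XY(2)] .
  obtain t a where X: "t \<in> S" "a \<in> carrier R" "X = lfrac R S t (a \<otimes> s)"
    using L_cases[OF XY(1)] match Y(1) by metis
  show "loc_incl (X \<otimes>\<^bsub>L\<^esub> Y) = loc_incl X \<otimes>\<^bsub>T.L\<^esub> loc_incl Y"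
    using X Y S_carrier subset
    by (simp add: mult_match loc_incl_lfrac T.mult_match subsetD)
next
  fix X Y assume XY: "X \<in> carrier L" "Y \<in> carrier L"
  show "loc_incl (X \<oplus>\<^bsub>L\<^esub> Y) = loc_incl X \<oplus>\<^bsub>T.L\<^esub> loc_incl Y"
    by (rule common2[OF XY]) (simp add: add_same loc_incl_lfrac T.add_same subsetD[OF subset])
next
  show "loc_incl \<one>\<^bsub>L\<^esub> = \<one>\<^bsub>T.L\<^esub>"
    using S_one by (simp add: L_simps T.L_simps loc_incl_lfrac)
qed

lemma loc_incl_inj: "inj_on loc_incl (carrier L)"
proof (rule inj_onI)
  fix X Y assume XY: "X \<in> carrier L" "Y \<in> carrier L" and eq: "loc_incl X = loc_incl Y"
  show "X = Y"
  proof (rule common2[OF XY])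
    fix s a b
    assume c: "s \<in> S" "a \<in> carrier R" "b \<in> carrier R"
      and X: "X = lfrac R S s a" and Y: "Y = lfrac R S s b"
    have "lfrac R T s a = lfrac R T s b" using eq c by (simp add: X Y loc_incl_lfrac)
    then show "X = Y" using T.lfrac_same_denom_iff c subset X Y by (simp add: subsetD)
  qed
qed

lemma loc_incl_R_fixing: "R_fixing R S T loc_incl"
  using S_one by (simp add: R_fixing_def loc_map_def loc_incl_lfrac)

lemma loc_incl_surj:
  assumes "T \<subseteq> LSat R S"
  shows "loc_incl ` carrier L = carrier T.L"
proof
  show "loc_incl ` carrier L \<subseteq> carrier T.L"
    using loc_incl_hom by (auto simp: ring_hom_def)
  show "carrier T.L \<subseteq> loc_incl ` carrier L"
  proof
    fix Z assume "Z \<in> carrier T.L"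
    then obtain t r where t: "t \<in> T" "r \<in> carrier R" "Z = lfrac R T t r" by (rule T.L_cases)
    obtain w where w: "t \<in> carrier R" "w \<in> carrier R" "w \<otimes> t \<in> S"
      using LSatE[OF subsetD[OF assms t(1)]] .
    have "Z = lfrac R T (w \<otimes> t) (w \<otimes> r)"
      unfolding t(3) using t w subset one_neq_zero
      by (subst T.lfrac_eq_iff) (auto intro!: T.relI[of _ _ _ _ w \<one>])
    also have "\<dots> = loc_incl (lfrac R S (w \<otimes> t) (w \<otimes> r))"
      using t w by (simp add: loc_incl_lfrac)
    finally show "Z \<in> loc_incl ` carrier L" using t w lfrac_closed by auto
  qed
qed

lemma R_fixing_hom_unique:
  assumes hom: "\<psi> \<in> ring_hom L T.L" and ext: "\<psi> \<in> extensional (carrier L)"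
    and fixing: "R_fixing R S T \<psi>"
  shows "\<psi> = loc_incl"
proof (rule extensionalityI[OF ext])
  show "loc_incl \<in> extensional (carrier L)" by (simp add: loc_incl_def)
next
  fix X assume X: "X \<in> carrier L"
  then obtain s r where sr: "s \<in> S" "r \<in> carrier R" "X = lfrac R S s r" by (rule L_cases)
  interpret LT: ring T.L by (rule T.ring_localization)
  have sT: "s \<in> T" using sr subset by blast
  have unit: "loc_map R T s \<in> Units T.L"
    using T.loc_map_Units_iff[OF S_carrier[OF sr(1)]] sT T.S_subset_LSat by blast
  have sol: "loc_map R T s \<otimes>\<^bsub>T.L\<^esub> \<chi> X = loc_map R T r"
    if "\<chi> \<in> ring_hom L T.L" "R_fixing R S T \<chi>" for \<chi>
  proof -
    have "loc_map R S s \<in> carrier L"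
      unfolding loc_map_def using S_one S_carrier sr by (simp add: lfrac_closed)
    then have "\<chi> (loc_map R S s \<otimes>\<^bsub>L\<^esub> X) = \<chi> (loc_map R S s) \<otimes>\<^bsub>T.L\<^esub> \<chi> X"
      using ring_hom_mult[OF that(1)] X by blast
    then show ?thesis
      using that(2) sr S_carrier by (simp add: loc_map_mult_lfrac R_fixing_def)
  qed
  have "loc_map R T s \<otimes>\<^bsub>T.L\<^esub> \<psi> X = loc_map R T s \<otimes>\<^bsub>T.L\<^esub> loc_incl X"
    using sol[OF hom fixing] sol[OF loc_incl_hom loc_incl_R_fixing] by simp
  then show "\<psi> X = loc_incl X"
    using LT.Units_l_cancel[OF unit] ring_hom_closed[OF hom X] ring_hom_closed[OF loc_incl_hom X]
    by simp
qed

lemma ex1_R_fixing_iso: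
  assumes "T \<subseteq> LSat R S"
  shows "\<exists>!\<phi>. \<phi> \<in> ring_iso L T.L \<and> \<phi> \<in> extensional (carrier L) \<and> R_fixing R S T \<phi>"
proof (rule ex1I[of _ loc_incl])
  show "loc_incl \<in> ring_iso L T.L \<and> loc_incl \<in> extensional (carrier L)
      \<and> R_fixing R S T loc_incl"
    using loc_incl_hom loc_incl_inj loc_incl_surj[OF assms] loc_incl_R_fixing
    by (auto simp: ring_iso_def bij_betw_def loc_incl_def)
qed (auto simp: ring_iso_def intro: R_fixing_hom_unique)

end


section \<open>Characterizations of the left saturation\<close>

theorem theorem7p7:
  fixes R :: "('a, 'b) ring_scheme" (structure) and S :: "'a set"
  assumes "nc_domain R" and "left_ore_set R S"
  shows
    \<comment> \<open>(a)\<close>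
    "left_ore_set R (LSat R S)
     \<comment> \<open>(b)\<close>
     \<and> LSat R S = {r \<in> carrier R. loc_map R S r \<in> Units (ore_localization R S)}
     \<and> (\<forall>s\<in>S. \<forall>r\<in>carrier R.
          lfrac R S s r \<in> Units (ore_localization R S) \<longleftrightarrow> r \<in> LSat R S)
     \<comment> \<open>(c)\<close>
     \<and> saturated R (LSat R S) \<and> S \<subseteq> LSat R S
     \<and> (\<forall>T. saturated R T \<and> S \<subseteq> T \<longrightarrow> LSat R S \<subseteq> T)
     \<comment> \<open>(d)\<close>
     \<and> (\<exists>!\<phi>. \<phi> \<in> ring_iso (ore_localization R S) (ore_localization R (LSat R S))
             \<and> \<phi> \<in> extensional (carrier (ore_localization R S))
             \<and> R_fixing R S (LSat R S) \<phi>)"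
proof -
  interpret left_ore R S
    using assms by (simp add: left_ore_def left_ore_axioms_def)
  interpret incl: left_ore_subset R S "LSat R S"
    using assms left_ore_set_LSat S_subset_LSat
    by (simp add: left_ore_subset_def left_ore_subset_axioms_def left_ore_def left_ore_axioms_def)
  have "LSat R S = {r \<in> carrier R. loc_map R S r \<in> Units L}"
    using loc_map_Units_iff by (auto simp: LSat_def)
  then show ?thesis
    using left_ore_set_LSat lfrac_Units_iff saturated_LSat S_subset_LSat LSat_least
      incl.ex1_R_fixing_iso
    by simp
qed

end
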